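(* Let $q>1$ and $c\ge1$, and let $p_0>q$ be the root of the equation $$\frac{p_0-q}{p_0}\Big(\frac{p_0}{p_0-1}\Big)^q c=1 .$$ Then for every $p\in[q,p_0)$ there is a constant $c'=c'(p,q,c)$, depending only on $p,q,c$, such that the following holds. If $g:(0,1]\to[0,\infty)$ is a non-increasing integrable function satisfying $$\frac1t\int_0^t g^q\le c\Big(\frac1t\int_0^t g\Big)^q\qquad\text{for all } t\in(0,1],$$ then $$\frac1t\int_0^t g^p\le c'\Big(\frac1t\int_0^t g\Big)^p\qquad\text{for all } t\in(0,1].$$ As a consequence, every such $g$ belongs to $L^p((0,1])$ for every $p\in[q,p_0)$. *)

theory Defs
  imports "HOL-Analysis.Analysis"
begin

text \<open>
  The average of \<open>g\<^sup>p\<close> is taken in \<open>[0, \<infinity>]\<close>: for a nonnegative function it always exists,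
  and bounding it by a real number entails that \<open>g\<^sup>p\<close> is integrable. With the Bochner
  integral, whose value is \<open>0\<close> on non-integrable functions, this would be lost.
  The average of \<open>g\<close> itself is a real number, so the predicate is meant for functions \<open>g\<close>
  that are integrable on \<open>(0, 1]\<close>, and for a constant \<open>c \<ge> 0\<close>, as \<open>ennreal\<close> truncates
  negative numbers to \<open>0\<close>.
\<close>

definition reverse_Holder :: "real \<Rightarrow> real \<Rightarrow> (real \<Rightarrow> real) \<Rightarrow> bool" where
  "reverse_Holder p c g \<longleftrightarrow>
     (\<forall>t\<in>{0<..1}.
        ennreal (1 / t) * (\<integral>\<^sup>+x\<in>{0<..t}. ennreal (g x powr p) \<partial>lborel)
          \<le> ennreal (c * (1 / t * (LINT x:{0<..t}|lborel. g x)) powr p))"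

definition admissible :: "(real \<Rightarrow> real) \<Rightarrow> bool" where
  "admissible g \<longleftrightarrow>
     (\<forall>x\<in>{0<..1}. 0 \<le> g x) \<and> antimono_on {0<..1} g \<and> set_integrable lborel {0<..1} g"

end

theory Submission
  imports Defs
begin

text \<open>
  Let \<open>G t\<close> and \<open>A t\<close> be the averages of \<open>g\<close> and \<open>g\<^sup>q\<close> over \<open>(0, t]\<close>, and put \<open>\<rho> = 1 - 1 / p\<^sub>0\<close>,
  \<open>a = \<rho> powr (q - 1)\<close>. The equation for \<open>p\<^sub>0\<close> says \<open>\<rho> powr q = c * (1 - q / p\<^sub>0)\<close>.
  Differentiating and bounding \<open>g\<^sup>q\<close> from below by the tangent of \<open>x powr q\<close> at \<open>\<rho> * G t\<close> shows
  that \<open>K t = t powr (q / p\<^sub>0) * (A t - a * G t powr q)\<close> is non-decreasing. Since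
  \<open>G t powr q \<le> A t \<le> c * G t powr q\<close> by Jensen and the hypothesis, the function
  \<open>t powr (1 / p\<^sub>0) * G t\<close> is non-decreasing up to the constant factor \<open>C = ((c - a) / (1 - a)) powr (1 / q)\<close>.
  As \<open>g \<le> G\<close>, this gives \<open>g s \<le> C * (t / s) powr (1 / p\<^sub>0) * G t\<close> for \<open>s \<le> t\<close>, whose \<open>p\<close>-th power
  is integrable for \<open>p < p\<^sub>0\<close>.
\<close>

section \<open>Monotonicity from derivatives known off a countable set\<close>

lemma nondecreasing_countable_deriv_pos:
  fixes f :: "real \<Rightarrow> real"
  assumes "a \<le> b" and cont: "continuous_on {a..b} f" and "countable E"
    and deriv: "\<And>x. x \<in> {a<..<b} - E \<Longrightarrow> \<exists>D>0. (f has_real_derivative D) (at x)"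
  shows "f a \<le> f b"
proof (rule ccontr)
  assume "\<not> f a \<le> f b"
  then have less: "f b < f a" by simp
  have "countable (f ` E)" using \<open>countable E\<close> by simp
  then have "\<not> {f b<..<f a} \<subseteq> f ` E"
    using less uncountable_open_interval countable_subset by blast
  then obtain y where y: "f b < y" "y < f a" "y \<notin> f ` E"
    by (metis greaterThanLessThan_iff subsetI)
  define T where "T = {x \<in> {a..b}. f x = y}"
  have "T \<noteq> {}"
    using IVT2'[of f b y a] y cont \<open>a \<le> b\<close> by (auto simp: T_def)
  moreover have "compact T"
  proof -
    have "closed ({a..b} \<inter> f -` {y})"
      using cont by (intro continuous_closed_preimage) auto
    moreover have "T = {a..b} \<inter> f -` {y}" by (auto simp: T_def)
    ultimately show ?thesis
      by (metis compact_Icc compact_Int_closed inf_le1 inf.absorb_iff2)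
  qed
  ultimately obtain z where z: "z \<in> T" "\<And>x. x \<in> T \<Longrightarrow> x \<le> z"
    using compact_attains_sup[of T] by metis
  have "f z = y" "a \<le> z" "z \<le> b" using z by (auto simp: T_def)
  with y have "a < z" "z < b" "z \<notin> E" by (auto simp: less_le)
  with deriv[of z] obtain D where "D > 0" "(f has_real_derivative D) (at z)" by auto
  then obtain d where d: "d > 0" "\<And>h. 0 < h \<Longrightarrow> h < d \<Longrightarrow> f z < f (z + h)"
    using DERIV_pos_inc_right[of f D z] by metis
  define h where "h = min (d / 2) ((b - z) / 2)"
  have h: "0 < h" "h < d" "z + h \<le> b" using d \<open>z < b\<close> by (auto simp: h_def min_def field_simps)
  have "continuous_on {z + h..b} f"
    using cont by (rule continuous_on_subset) (use h \<open>a < z\<close> in auto)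
  then obtain x where "z + h \<le> x" "x \<le> b" "f x = y"
    using IVT2'[of f b y "z + h"] d(2)[OF h(1,2)] y h \<open>f z = y\<close> by force
  then have "x \<in> T" using h \<open>a < z\<close> by (auto simp: T_def)
  with z(2)[of x] h \<open>z + h \<le> x\<close> show False by auto
qed

text \<open>Adding \<open>k * x\<close> with small \<open>k > 0\<close> makes the derivative
  strictly positive, at a cost of at most \<open>e\<close> over the whole interval.\<close>

lemma nondecreasing_countable_deriv_nonneg:
  fixes f :: "real \<Rightarrow> real"
  assumes "a \<le> b" and cont: "continuous_on {a..b} f" and "countable E"
    and deriv: "\<And>x. x \<in> {a<..<b} - E \<Longrightarrow> \<exists>D\<ge>0. (f has_real_derivative D) (at x)"
  shows "f a \<le> f b"
proof (rule field_le_epsilon)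
  fix e :: real assume "e > 0"
  define k where "k = e / (b - a + 1)"
  have k: "k > 0" "k * (b - a) \<le> e"
    using \<open>a \<le> b\<close> \<open>e > 0\<close> by (auto simp: k_def field_simps)
  have "f a + k * a \<le> f b + k * b"
  proof (rule nondecreasing_countable_deriv_pos[OF \<open>a \<le> b\<close> _ \<open>countable E\<close>])
    show "continuous_on {a..b} (\<lambda>x. f x + k * x)" by (intro continuous_intros cont)
    fix x assume "x \<in> {a<..<b} - E"
    with deriv obtain D where "D \<ge> 0" "(f has_real_derivative D) (at x)" by blast
    then have "((\<lambda>x. f x + k * x) has_real_derivative D + k) (at x)"
      by (auto intro!: derivative_eq_intros)
    with \<open>D \<ge> 0\<close> k show "\<exists>D>0. ((\<lambda>x. f x + k * x) has_real_derivative D) (at x)"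
      by (intro exI[of _ "D + k"]) auto
  qed
  with k show "f a \<le> f b + e" by (simp add: algebra_simps)
qed

section \<open>The tangent inequality and the Lyapunov function\<close>

text \<open>Convexity gives this on the open half-line. The boundary cases are checked by hand: for
  \<open>y = 0\<close> the left side vanishes, for \<open>x = 0\<close> it is
  \<open>(1 - q) * y powr q\<close>, which is negative.\<close>

lemma powr_ge_tangent:
  fixes x y q :: real
  assumes "x \<ge> 0" "y \<ge> 0" "q > 1"
  shows "y powr q + q * y powr (q - 1) * (x - y) \<le> x powr q"
proof (cases "y = 0")
  case False
  then have y: "y > 0" using assms by simp
  have yq: "y powr q = y * y powr (q - 1)" using y by (simp add: powr_mult_base)
  show ?thesis
  proof (cases "x = 0")
    case True
    then show ?thesis using assms y by (simp add: yq algebra_simps)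
  next
    case False
    with assms have x: "x > 0" by simp
    have "((\<lambda>x. x powr q) has_real_derivative q * y powr (q - 1)) (at y)"
      using y by (auto intro!: derivative_eq_intros)
    then have "x powr q - y powr q \<ge> q * y powr (q - 1) * (x - y)"
      using x y assms
      by (intro convex_on_imp_above_tangent[OF powr_convex[of q]])
        (auto simp: interior_open intro: has_field_derivative_at_within)
    then show ?thesis by simp
  qed
qed (use assms in simp)

lemma integral_has_real_derivative_isCont:
  fixes h :: "real \<Rightarrow> real"
  assumes "h integrable_on {a..b}" "a < x" "x < b" "isCont h x"
  shows "((\<lambda>u. integral {a..u} h) has_real_derivative h x) (at x)"
proof -
  have "((\<lambda>u. integral {a..u} h) has_vector_derivative h x) (at x within {a..b} - {})"
    using assms by (intro integral_has_vector_derivative_continuous_at)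
      (auto intro: continuous_at_imp_continuous_at_within)
  then show ?thesis
    using assms by (simp add: at_within_Icc_at has_real_derivative_iff_has_vector_derivative)
qed

text \<open>\<open>I\<close> and \<open>F\<close> stand for the integrals of \<open>g\<close> and
  \<open>g powr q\<close> over (0, x], so \<open>K\<close> is the function of the overview with the
  averages written as \<open>I x / x\<close> and \<open>F x / x\<close>. The factor of
  \<open>I x powr q\<close> in \<open>K\<close> is chosen so that the terms of K' linear in
  \<open>g x\<close> cancel against the tangent; \<open>root\<close> makes the rest cancel
  too.\<close>

lemma lyapunov_mono:
  fixes q c p s t :: real and g I F :: "real \<Rightarrow> real"
  assumes "q > 1" "p > q" and root: "(1 - 1 / p) powr q = c * (1 - q / p)"
    and "0 < s" "s \<le> t" "countable E"
    and cont: "continuous_on {s..t} I" "continuous_on {s..t} F"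
    and deriv: "\<And>x. x \<in> {s<..<t} - E \<Longrightarrow> (I has_real_derivative g x) (at x)"
      "\<And>x. x \<in> {s<..<t} - E \<Longrightarrow> (F has_real_derivative g x powr q) (at x)"
    and nonneg: "\<And>x. x \<in> {s..t} \<Longrightarrow> g x \<ge> 0" and pos: "\<And>x. x \<in> {s..t} \<Longrightarrow> I x > 0"
    and le: "\<And>x. x \<in> {s..t} \<Longrightarrow> F x \<le> c * (x powr (1 - q) * I x powr q)"
  defines "K \<equiv> \<lambda>x. x powr (q / p - 1) * F x - (1 - 1 / p) powr (q - 1) * (x powr (q / p - q) * I x powr q)"
  shows "K s \<le> K t"
proof (rule nondecreasing_countable_deriv_nonneg[OF \<open>s \<le> t\<close> _ \<open>countable E\<close>])
  show "continuous_on {s..t} K"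
    unfolding K_def using \<open>0 < s\<close> pos by (intro continuous_intros cont) force+
  fix x assume x: "x \<in> {s<..<t} - E"
  define e where "e = q / p"
  define r where "r = 1 - 1 / p"
  define a where "a = r powr (q - 1)"
  have r: "r > 0" and e: "e < 1" and qe: "q - e = q * r"
    using assms(1,2) by (auto simp: r_def e_def field_simps)
  have ra: "a * r = r powr q" using r by (simp add: a_def powr_mult_base mult.commute)
  have x0: "x > 0" and g: "g x \<ge> 0" and I: "I x > 0" and F: "F x \<le> c * (x powr (1 - q) * I x powr q)"
    using x \<open>0 < s\<close> nonneg[of x] pos[of x] le[of x] by auto
  define D where "D = (e - 1) * x powr (e - 2) * F x + x powr (e - 1) * g x powr q
    - a * ((e - q) * x powr (e - q - 1) * I x powr q + x powr (e - q) * (q * I x powr (q - 1) * g x))"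
  have "(K has_real_derivative D) (at x)"
    unfolding K_def D_def e_def[symmetric] r_def[symmetric] a_def[symmetric]
    using x0 I
    by (auto intro!: derivative_eq_intros deriv x simp: algebra_simps)
  moreover have "D \<ge> 0"
  proof -
    \<comment> \<open>The point of tangency: by \<open>yq1\<close> its slope is
      \<open>q * a * (I x / x) powr (q - 1)\<close>, the coefficient of \<open>g x\<close> in
      \<open>D\<close> up to sign and a power of \<open>x\<close>.\<close>
    define y where "y = r * (I x / x)"
    have yq: "y powr q = r powr q * I x powr q * x powr (- q)"
      and yq1: "y powr (q - 1) = a * I x powr (q - 1) * x powr (1 - q)"
      using r I x0 by (auto simp: y_def a_def powr_mult powr_divide powr_minus powr_diff field_simps)
    have yy: "y powr (q - 1) * y = y powr q"
      using powr_mult_base[of y "q - 1"] r I x0 by (simp add: y_def mult.commute)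
    have "x powr (e - 1) * (y powr q + q * y powr (q - 1) * (g x - y)) \<le> x powr (e - 1) * g x powr q"
      using powr_ge_tangent[of "g x" y q] g r I x0 \<open>q > 1\<close> by (intro mult_left_mono) (auto simp: y_def)
    also have "y powr q + q * y powr (q - 1) * (g x - y) = (1 - q) * y powr q + q * y powr (q - 1) * g x"
      unfolding yy[symmetric] by (simp add: algebra_simps)
    also have "x powr (e - 1) * \<dots>
        = (1 - q) * r powr q * I x powr q * (x powr (e - 1) * x powr (- q))
          + q * a * I x powr (q - 1) * g x * (x powr (e - 1) * x powr (1 - q))"
      unfolding yq yq1 by (simp add: algebra_simps)
    also have "\<dots> = (1 - q) * r powr q * I x powr q * x powr (e - q - 1)
          + q * a * I x powr (q - 1) * g x * x powr (e - q)"
      unfolding powr_add[symmetric] by (simp add: algebra_simps)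
    finally have 1: "(1 - q) * r powr q * I x powr q * x powr (e - q - 1)
          + q * a * I x powr (q - 1) * g x * x powr (e - q) \<le> x powr (e - 1) * g x powr q" .
    have "(1 - e) * x powr (e - 2) * F x \<le> (1 - e) * x powr (e - 2) * (c * (x powr (1 - q) * I x powr q))"
      using F e by (intro mult_left_mono) auto
    also have "\<dots> = (c * (1 - e)) * I x powr q * (x powr (e - 2) * x powr (1 - q))" by simp
    also have "\<dots> = r powr q * I x powr q * x powr (e - q - 1)"
      unfolding root[folded e_def r_def, symmetric] powr_add[symmetric] by (simp add: algebra_simps)
    finally have 2: "(1 - e) * x powr (e - 2) * F x \<le> r powr q * I x powr q * x powr (e - q - 1)" .
    have "a * (q - e) = q * r powr q" unfolding qe using ra by (simp add: algebra_simps)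
    then have 3: "a * (q - e) * x powr (e - q - 1) * I x powr q = q * r powr q * I x powr q * x powr (e - q - 1)"
      by (simp add: algebra_simps)
    \<comment> \<open>In units of \<open>r powr q * I x powr q * x powr (e - q - 1)\<close>, facts
      1, 2 and 3 contribute 1 - q, -1 and q, which sum to 0.\<close>
    show ?thesis unfolding D_def using 1 2 3 by (simp add: algebra_simps)
  qed
  ultimately show "\<exists>D\<ge>0. (K has_real_derivative D) (at x)" by blast
qed

section \<open>Jensen's inequality and growth of averages\<close>

text \<open>\<open>admissible\<close> controls \<open>g\<close> only on (0, 1], while indefinite
  integrals are taken over closed intervals; the two domains differ by a null set.\<close>

lemma
  fixes f :: "real \<Rightarrow> 'a::banach"
  shows integrable_on_Ioc_iff_Icc: "f integrable_on {a<..b} \<longleftrightarrow> f integrable_on {a..b}"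
    and integral_Ioc_eq_Icc: "integral {a<..b} f = integral {a..b} f"
proof -
  have neg: "negligible ({a..b} - {a<..b})" "negligible ({a<..b} - {a..b})"
    by (rule negligible_subset[of "{a}"]; auto)+
  show "f integrable_on {a<..b} \<longleftrightarrow> f integrable_on {a..b}"
    using neg by (intro integrable_spike_set_eq negligible_Un) auto
  show "integral {a<..b} f = integral {a..b} f"
    using neg by (intro integral_spike_set) (auto elim!: negligible_subset)
qed

text \<open>Integrate the tangent inequality at the mean value \<open>y\<close> of \<open>g\<close>:
  the linear term integrates to 0. The comparison is made on (0, s], since \<open>g 0\<close> may be
  negative.\<close>

lemma Jensen_integral_powr:
  fixes g :: "real \<Rightarrow> real"
  assumes "q > 1" "s > 0" and nonneg: "\<And>x. x \<in> {0<..s} \<Longrightarrow> g x \<ge> 0"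
    and int: "g integrable_on {0..s}" "(\<lambda>x. g x powr q) integrable_on {0..s}"
  shows "s powr (1 - q) * integral {0..s} g powr q \<le> integral {0..s} (\<lambda>x. g x powr q)"
proof -
  define J where "J = integral {0..s} g"
  define y where "y = J / s"
  have "J = integral {0<..s} g" by (simp add: J_def integral_Ioc_eq_Icc)
  then have "J \<ge> 0" using nonneg int(1) by (auto intro!: integral_nonneg simp: integrable_on_Ioc_iff_Icc)
  then have y: "y \<ge> 0" using \<open>s > 0\<close> by (simp add: y_def)
  have "((\<lambda>x. y powr q + q * y powr (q - 1) * (g x - y)) has_integral
      (s * y powr q + q * y powr (q - 1) * (J - s * y))) {0..s}"
    using has_integral_const_real[of "y powr q" 0 s] has_integral_const_real[of y 0 s]
      integrable_integral[OF int(1)] \<open>s > 0\<close>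
    by (intro has_integral_add has_integral_mult_right has_integral_diff) (auto simp: J_def)
  moreover have "J - s * y = 0" using \<open>s > 0\<close> by (simp add: y_def)
  ultimately have lin: "((\<lambda>x. y powr q + q * y powr (q - 1) * (g x - y)) has_integral s * y powr q) {0..s}"
    by simp
  have "s powr (1 - q) * J powr q = s * y powr q"
    using \<open>s > 0\<close> \<open>J \<ge> 0\<close> by (simp add: y_def powr_divide powr_diff)
  also have "\<dots> = integral {0<..s} (\<lambda>x. y powr q + q * y powr (q - 1) * (g x - y))"
    using lin by (simp add: integral_Ioc_eq_Icc integral_unique)
  also have "\<dots> \<le> integral {0<..s} (\<lambda>x. g x powr q)"
    using lin int nonneg y \<open>q > 1\<close>
    by (intro integral_le powr_ge_tangent) (auto simp: integrable_on_Ioc_iff_Icc)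
  finally show ?thesis by (simp add: J_def integral_Ioc_eq_Icc)
qed

text \<open>Write \<open>G\<close> for the average of \<open>g\<close> and \<open>e = q / p\<close>.
  Jensen and \<open>le\<close> sandwich the Lyapunov function:
  \<open>(1 - a) * s powr e * G s powr q\<close> is at most its value at \<open>s\<close>, hence at
  most its value at \<open>t\<close>, which is at most
  \<open>(c - a) * t powr e * G t powr q\<close>. A q-th root finishes.\<close>

lemma average_growth:
  fixes q c p s t :: real and g :: "real \<Rightarrow> real"
  assumes "q > 1" "p > q" "c \<ge> 1" and root: "(1 - 1 / p) powr q = c * (1 - q / p)"
    and "0 < s" "s \<le> t" "t \<le> 1"
    and nonneg: "\<And>x. x \<in> {0<..1} \<Longrightarrow> g x \<ge> 0" and anti: "antimono_on {0<..1} g"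
    and int: "g integrable_on {0..1}" "(\<lambda>x. g x powr q) integrable_on {0..1}"
    and le: "\<And>x. x \<in> {0<..1} \<Longrightarrow>
      integral {0..x} (\<lambda>x. g x powr q) \<le> c * (x powr (1 - q) * integral {0..x} g powr q)"
  defines "a \<equiv> (1 - 1 / p) powr (q - 1)"
  shows "s powr (1 / p - 1) * integral {0..s} g
    \<le> ((c - a) / (1 - a)) powr (1 / q) * (t powr (1 / p - 1) * integral {0..t} g)"
proof -
  define I where "I x = integral {0..x} g" for x
  define F where "F x = integral {0..x} (\<lambda>x. g x powr q)" for x
  have intI: "g integrable_on {0..x}" and intF: "(\<lambda>x. g x powr q) integrable_on {0..x}" if "x \<le> 1" for x
    using int that by (auto elim!: integrable_on_subinterval)
  have I_mono: "I x \<le> I y" if "x \<le> y" "y \<le> 1" for x y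
    unfolding I_def integral_Ioc_eq_Icc[symmetric] using that nonneg intI[of x] intI[of y]
    by (intro integral_subset_le) (auto simp: integrable_on_Ioc_iff_Icc)
  have I_nonneg: "I x \<ge> 0" if "0 \<le> x" "x \<le> 1" for x
    using I_mono[of 0 x] that by (simp add: I_def)
  have a: "a > 0" "a < 1"
    using assms(1,2) powr_less_mono2[of "q - 1" "1 - 1 / p" 1] by (auto simp: a_def)
  show ?thesis
  \<comment> \<open>\<open>lyapunov_mono\<close> needs \<open>I\<close> positive on the whole of
    [s, t]; as \<open>I\<close> is non-decreasing, \<open>I s > 0\<close> suffices.\<close>
  proof (cases "I s = 0")
    case True
    then show ?thesis
      using I_nonneg[of t] \<open>0 < s\<close> \<open>s \<le> t\<close> \<open>t \<le> 1\<close> by (simp add: I_def[symmetric])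
  next
    case False
    then have Is: "I s > 0" using I_nonneg[of s] \<open>0 < s\<close> \<open>s \<le> t\<close> \<open>t \<le> 1\<close> by simp
    define e where "e = q / p"
    \<comment> \<open>A monotone function has only countably many discontinuities. The sign makes it
      increasing; off \<open>E\<close> the integrals \<open>I\<close> and \<open>F\<close> are
      differentiable.\<close>
    define E where "E = {x \<in> {0<..<1}. \<not> isCont (\<lambda>x. - g x) x}"
    have "mono_on {0<..<1} (\<lambda>x. - g x)"
      using anti by (auto simp: monotone_on_def)
    then have E: "countable E" unfolding E_def by (rule mono_on_ctble_discont_open[rotated]) simp
    have cont: "continuous_on {s..t} I" "continuous_on {s..t} F"
      using indefinite_integral_continuous_1[OF int(1)] indefinite_integral_continuous_1[OF int(2)]
        \<open>0 < s\<close> \<open>t \<le> 1\<close> by (auto simp: I_def F_def elim!: continuous_on_subset)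
    have isCont: "isCont g x" "isCont (\<lambda>x. g x powr q) x" if x: "x \<in> {s<..<t} - E" for x
    proof -
      have x01: "x \<in> {0<..<1}" using x \<open>0 < s\<close> \<open>t \<le> 1\<close> by auto
      with x have "isCont (\<lambda>x. - g x) x" by (auto simp: E_def)
      from isCont_minus[OF this] show g: "isCont g x" by simp
      \<comment> \<open>\<open>g x\<close> may be 0, where continuity of the power requires
        \<open>g\<close> to be nonnegative nearby.\<close>
      have "eventually (\<lambda>x. x \<in> {0<..<1}) (at x)"
        using x01 by (intro eventually_at_in_open') auto
      then have "eventually (\<lambda>x. 0 \<le> g x) (at x)"
        by eventually_elim (use nonneg in auto)
      then show "isCont (\<lambda>x. g x powr q) x"
        using g \<open>q > 1\<close> unfolding isCont_def by (intro tendsto_powr') auto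
    qed
    have "s powr (e - 1) * F s - a * (s powr (e - q) * I s powr q)
      \<le> t powr (e - 1) * F t - a * (t powr (e - q) * I t powr q)"
      unfolding a_def e_def
    proof (rule lyapunov_mono[where g = g, OF assms(1,2) root assms(5,6) E cont])
      show "(I has_real_derivative g x) (at x)" if "x \<in> {s<..<t} - E" for x
        unfolding I_def using that \<open>0 < s\<close> \<open>t \<le> 1\<close> isCont(1)[OF that] int(1)
        by (intro integral_has_real_derivative_isCont) auto
      show "(F has_real_derivative g x powr q) (at x)" if "x \<in> {s<..<t} - E" for x
        unfolding F_def using that \<open>0 < s\<close> \<open>t \<le> 1\<close> isCont(2)[OF that] int(2)
        by (intro integral_has_real_derivative_isCont) auto
      show "I x > 0" if "x \<in> {s..t}" for x
        using I_mono[of s x] Is that \<open>t \<le> 1\<close> by auto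
    qed (use \<open>0 < s\<close> \<open>t \<le> 1\<close> nonneg le in \<open>auto simp: I_def F_def\<close>)
    moreover have "s powr (e - q) * I s powr q \<le> s powr (e - 1) * F s"
    proof -
      have "s powr (e - 1) * (s powr (1 - q) * I s powr q) \<le> s powr (e - 1) * F s"
        unfolding I_def F_def using \<open>q > 1\<close> \<open>0 < s\<close> \<open>s \<le> t\<close> \<open>t \<le> 1\<close> nonneg intI intF
        by (intro mult_left_mono Jensen_integral_powr) auto
      then show ?thesis by (simp add: mult.assoc[symmetric] powr_add[symmetric])
    qed
    moreover have "t powr (e - 1) * F t \<le> c * (t powr (e - q) * I t powr q)"
    proof -
      have "t powr (e - 1) * F t \<le> t powr (e - 1) * (c * (t powr (1 - q) * I t powr q))"
        unfolding I_def F_def using \<open>0 < s\<close> \<open>s \<le> t\<close> \<open>t \<le> 1\<close>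
        by (intro mult_left_mono le) auto
      also have "\<dots> = c * ((t powr (e - 1) * t powr (1 - q)) * I t powr q)" by simp
      finally show ?thesis by (simp add: powr_add[symmetric])
    qed
    ultimately have "(1 - a) * (s powr (e - q) * I s powr q) \<le> (c - a) * (t powr (e - q) * I t powr q)"
      by (simp add: algebra_simps)
    then have "s powr (e - q) * I s powr q \<le> (c - a) / (1 - a) * (t powr (e - q) * I t powr q)"
      using a by (simp add: field_simps)
    then have le_root: "(s powr (e - q) * I s powr q) powr (1 / q)
        \<le> ((c - a) / (1 - a) * (t powr (e - q) * I t powr q)) powr (1 / q)"
      using \<open>q > 1\<close> by (intro powr_mono2) auto
    have root_eq: "(x powr (e - q) * I x powr q) powr (1 / q) = x powr (1 / p - 1) * I x" if "0 < x" "x \<le> 1" for x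
    proof -
      have "(e - q) * (1 / q) = 1 / p - 1" using assms(1,2) by (simp add: e_def field_simps)
      moreover have "I x powr (q * (1 / q)) = I x"
        using \<open>q > 1\<close> I_nonneg[of x] that by simp
      ultimately show ?thesis
        by (simp only: powr_mult powr_powr powr_ge_zero)
    qed
    have "0 < t" "s \<le> 1" using \<open>0 < s\<close> \<open>s \<le> t\<close> \<open>t \<le> 1\<close> by auto
    with le_root show ?thesis
      unfolding powr_mult[of "(c - a) / (1 - a)"] root_eq[OF \<open>0 < s\<close> \<open>s \<le> 1\<close>] root_eq[OF \<open>0 < t\<close> \<open>t \<le> 1\<close>]
      by (simp add: I_def)
  qed
qed

section \<open>Passing between extended and real integrals\<close>

text \<open>The case \<open>t = 1\<close> bounds the extended integral of \<open>g powr p\<close> by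
  a real number, hence makes it finite.\<close>

lemma reverse_Holder_imp_integrable:
  assumes g: "admissible g" and rh: "reverse_Holder p c g"
  shows "set_integrable lborel {0<..1} (\<lambda>x. g x powr p)"
proof -
  have [measurable]: "(\<lambda>x. indicator {0<..1} x * g x) \<in> borel_measurable lborel"
    using g by (auto simp: admissible_def set_integrable_def dest: borel_measurable_integrable)
  \<comment> \<open>Measurability is known only for \<open>g\<close> cut off outside (0, 1], so the
    cutoff is also put inside the power.\<close>
  have eq: "indicator {0<..1} x * g x powr p = indicator {0<..1} x * (indicator {0<..1} x * g x) powr p" for x
    by (auto simp: indicator_def)
  have "(\<lambda>x. indicator {0<..1} x * g x powr p) \<in> borel_measurable lborel"
    unfolding eq by measurable
  moreover have "(\<integral>\<^sup>+x. ennreal (norm (indicator {0<..1} x * g x powr p)) \<partial>lborel) < \<infinity>"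
  proof -
    have "(\<integral>\<^sup>+x. ennreal (norm (indicator {0<..1} x * g x powr p)) \<partial>lborel)
        = (\<integral>\<^sup>+x\<in>{0<..1}. ennreal (g x powr p) \<partial>lborel)"
      by (intro nn_integral_cong) (auto simp: indicator_def)
    also have "\<dots> < \<infinity>"
      using rh[unfolded reverse_Holder_def, rule_format, of 1] by (auto intro: le_less_trans)
    finally show ?thesis .
  qed
  ultimately show ?thesis
    unfolding set_integrable_def by (intro integrableI_bounded) auto
qed

lemma set_integrable_Ioc_imp_integral_Icc:
  fixes f :: "real \<Rightarrow> real"
  assumes "set_integrable lborel {0<..1} f" "t \<le> 1"
  shows "f integrable_on {0..t}" "(LINT x:{0<..t}|lborel. f x) = integral {0..t} f"
proof -
  have "set_integrable lborel {0<..t} f"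
    using assms by (auto intro: set_integrable_subset)
  from set_borel_integral_eq_integral[OF this]
  show "f integrable_on {0..t}" "(LINT x:{0<..t}|lborel. f x) = integral {0..t} f"
    by (simp_all add: integrable_on_Ioc_iff_Icc integral_Ioc_eq_Icc)
qed

lemma reverse_Holder_imp_integral_le:
  assumes g: "admissible g" and rh: "reverse_Holder q c g" and t: "t \<in> {0<..1}" and "c \<ge> 0"
  shows "integral {0..t} (\<lambda>x. g x powr q) \<le> c * (t powr (1 - q) * integral {0..t} g powr q)"
proof -
  define J where "J = integral {0..t} g"
  define X where "X = integral {0..t} (\<lambda>x. g x powr q)"
  have gi: "set_integrable lborel {0<..1} g" using g by (simp add: admissible_def)
  have J: "(LINT x:{0<..t}|lborel. g x) = J"
    using set_integrable_Ioc_imp_integral_Icc[OF gi] t by (simp add: J_def)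
  have "J = integral {0<..t} g" by (simp add: J_def integral_Ioc_eq_Icc)
  then have "J \<ge> 0"
    using g set_integrable_Ioc_imp_integral_Icc(1)[OF gi] t
    by (auto intro!: integral_nonneg simp: integrable_on_Ioc_iff_Icc admissible_def)
  have "(\<lambda>x. g x powr q) integrable_on {0<..t}"
    using set_integrable_Ioc_imp_integral_Icc(1)[OF reverse_Holder_imp_integrable[OF g rh]] t
    by (simp add: integrable_on_Ioc_iff_Icc)
  then have "((\<lambda>x. g x powr q) has_integral X) {0<..t}"
    by (simp add: X_def integral_Ioc_eq_Icc[symmetric] integrable_integral)
  then have nn: "(\<integral>\<^sup>+x\<in>{0<..t}. ennreal (g x powr q) \<partial>lborel) = ennreal X" and "X \<ge> 0"
    by (auto intro: nn_integral_has_integral_lebesgue' elim: has_integral_nonneg)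
  have "ennreal (1 / t) * ennreal X \<le> ennreal (c * (1 / t * J) powr q)"
    using rh[unfolded reverse_Holder_def, rule_format, OF t] by (simp only: nn J)
  \<comment> \<open>Removing \<open>ennreal\<close> is sound because \<open>c \<ge> 0\<close> keeps
    the right side nonnegative.\<close>
  then have "1 / t * X \<le> c * (1 / t * J) powr q"
    using t \<open>X \<ge> 0\<close> \<open>c \<ge> 0\<close> by (simp add: ennreal_mult'[symmetric] del: times_divide_eq_left)
  then have "X \<le> t * (c * (J / t) powr q)"
    using t by (simp add: field_simps)
  also have "\<dots> = c * (t powr (1 - q) * J powr q)"
    using t \<open>J \<ge> 0\<close> by (simp add: powr_divide powr_diff)
  finally show ?thesis by (simp add: X_def J_def)
qed

section \<open>From pointwise bounds to the self-improved inequality\<close>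

text \<open>The p-th power of \<open>bound\<close> is a multiple of \<open>s powr (- r)\<close> with
  \<open>r = p / P < 1\<close>. Its integral over (0, t] is a multiple of
  \<open>t powr (1 - r) / (1 - r)\<close>, whence the denominator in the constant.\<close>

lemma reverse_Holder_of_powr_bound:
  assumes "0 \<le> p" "p < P" "C \<ge> 0"
    and nonneg: "\<And>x. x \<in> {0<..1} \<Longrightarrow> g x \<ge> 0"
    and avg: "\<And>t. t \<in> {0<..1} \<Longrightarrow> 0 \<le> (LINT x:{0<..t}|lborel. g x)"
    and bound: "\<And>s t. 0 < s \<Longrightarrow> s \<le> t \<Longrightarrow> t \<le> 1 \<Longrightarrow>
      g s \<le> C * (t / s) powr (1 / P) * (1 / t * (LINT x:{0<..t}|lborel. g x))"
  shows "reverse_Holder p (C powr p / (1 - p / P)) g"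
  unfolding reverse_Holder_def
proof
  fix t :: real assume t: "t \<in> {0<..1}"
  define A where "A = 1 / t * (LINT x:{0<..t}|lborel. g x)"
  define r where "r = p / P"
  define M where "M = C powr p * t powr r * A powr p"
  have r: "0 \<le> r" "r < 1" using assms(1,2) by (auto simp: r_def)
  have A: "A \<ge> 0" using avg[OF t] t by (simp add: A_def)
  have "((\<lambda>x. x powr (- r)) has_integral t powr (- r + 1) / (- r + 1)) {0..t}"
    using r t by (intro has_integral_powr_from_0) auto
  then have "((\<lambda>x. M * x powr (- r)) has_integral M * (t powr (- r + 1) / (- r + 1))) {0..t}"
    by (rule has_integral_mult_right)
  then have nn: "(\<integral>\<^sup>+x\<in>{0..t}. ennreal (M * x powr (- r)) \<partial>lborel) = ennreal (M * (t powr (- r + 1) / (- r + 1)))"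
    by (intro nn_integral_has_integral_lebesgue') (auto simp: M_def)
  have "(\<integral>\<^sup>+x\<in>{0<..t}. ennreal (g x powr p) \<partial>lborel) \<le> (\<integral>\<^sup>+x\<in>{0..t}. ennreal (M * x powr (- r)) \<partial>lborel)"
  proof (intro nn_integral_mono)
    fix x :: real
    have "g x powr p \<le> M * x powr (- r)" if x: "0 < x" "x \<le> t"
    proof -
      have "g x powr p \<le> (C * (t / x) powr (1 / P) * A) powr p"
        using bound[of x t] nonneg[of x] x t \<open>0 \<le> p\<close> by (intro powr_mono2) (auto simp: A_def)
      also have "\<dots> = C powr p * (t / x) powr r * A powr p"
        by (simp add: powr_mult powr_powr r_def)
      also have "\<dots> = M * x powr (- r)"
        using x t by (simp add: M_def powr_divide powr_minus field_simps)
      finally show ?thesis .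
    qed
    then show "ennreal (g x powr p) * indicator {0<..t} x \<le> ennreal (M * x powr (- r)) * indicator {0..t} x"
      by (auto simp: indicator_def intro: ennreal_leI)
  qed
  then have "ennreal (1 / t) * (\<integral>\<^sup>+x\<in>{0<..t}. ennreal (g x powr p) \<partial>lborel)
      \<le> ennreal (1 / t) * ennreal (M * (t powr (- r + 1) / (- r + 1)))"
    unfolding nn by (rule mult_left_mono) simp
  also have "\<dots> = ennreal (1 / t * (M * (t powr (- r + 1) / (- r + 1))))"
    using t by (simp add: ennreal_mult'[symmetric] del: times_divide_eq_left)
  also have "1 / t * (M * (t powr (- r + 1) / (- r + 1)))
      = C powr p / (1 - p / P) * A powr p * ((t powr r * t powr (- r + 1)) / t)"
    by (simp add: M_def r_def mult_ac)
  also have "\<dots> = C powr p / (1 - p / P) * A powr p"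
    unfolding powr_add[symmetric] using t by simp
  finally show "ennreal (1 / t) * (\<integral>\<^sup>+x\<in>{0<..t}. ennreal (g x powr p) \<partial>lborel)
      \<le> ennreal (C powr p / (1 - p / P) * (1 / t * (LINT x:{0<..t}|lborel. g x)) powr p)"
    by (simp add: A_def)
qed

lemma reverse_Holder_self_improving:
  fixes q c P p :: real
  assumes "q > 1" "P > q" "c \<ge> 1" and root: "(1 - 1 / P) powr q = c * (1 - q / P)"
    and "0 \<le> p" "p < P" and g: "admissible g" and rh: "reverse_Holder q c g"
  defines "a \<equiv> (1 - 1 / P) powr (q - 1)"
  shows "reverse_Holder p ((((c - a) / (1 - a)) powr (1 / q)) powr p / (1 - p / P)) g"
proof (rule reverse_Holder_of_powr_bound[OF \<open>0 \<le> p\<close> \<open>p < P\<close> powr_ge_zero])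
  have nonneg: "\<And>x. x \<in> {0<..1} \<Longrightarrow> g x \<ge> 0" and anti: "antimono_on {0<..1} g"
    and gi: "set_integrable lborel {0<..1} g"
    using g by (auto simp: admissible_def)
  note gq = reverse_Holder_imp_integrable[OF g rh]
  note int = set_integrable_Ioc_imp_integral_Icc[OF gi]
  show "g x \<ge> 0" if "x \<in> {0<..1}" for x using nonneg that .
  show "0 \<le> (LINT x:{0<..t}|lborel. g x)" if "t \<in> {0<..1}" for t
    using that nonneg unfolding set_lebesgue_integral_def
    by (intro Bochner_Integration.integral_nonneg) (auto simp: indicator_def)
  fix s t :: real assume st: "0 < s" "s \<le> t" "t \<le> 1"
  let ?C = "((c - a) / (1 - a)) powr (1 / q)"
  \<comment> \<open>\<open>g s\<close> is the least value of \<open>g\<close> on (0, s]; this turns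
    growth of averages into a pointwise bound.\<close>
  have "s * g s \<le> integral {0..s} g"
  proof -
    have "s * g s = integral {0<..s} (\<lambda>x. g s)"
      using st by (simp add: integral_Ioc_eq_Icc)
    also have "\<dots> \<le> integral {0<..s} g"
      using st anti int(1)[of s]
      by (intro integral_le) (auto simp: integrable_on_Ioc_iff_Icc monotone_on_def)
    finally show ?thesis by (simp add: integral_Ioc_eq_Icc)
  qed
  then have "s powr (1 / P - 1) * (s * g s) \<le> s powr (1 / P - 1) * integral {0..s} g"
    by (rule mult_left_mono) simp
  also have "\<dots> \<le> ?C * (t powr (1 / P - 1) * integral {0..t} g)"
    unfolding a_def using assms(1-3) root st nonneg anti int(1)[of 1]
      set_integrable_Ioc_imp_integral_Icc(1)[OF gq, of 1]
      reverse_Holder_imp_integral_le[OF g rh]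
    by (intro average_growth) auto
  finally have "s powr (1 / P) * g s \<le> ?C * (t powr (1 / P - 1) * integral {0..t} g)"
    using st by (simp add: powr_diff)
  then have "g s \<le> ?C * (t powr (1 / P - 1) * integral {0..t} g) / s powr (1 / P)"
    using st by (simp add: pos_le_divide_eq mult.commute)
  also have "\<dots> = ?C * (t / s) powr (1 / P) * (1 / t * integral {0..t} g)"
    using st by (simp add: powr_diff powr_divide mult_ac)
  finally show "g s \<le> ?C * (t / s) powr (1 / P) * (1 / t * (LINT x:{0<..t}|lborel. g x))"
    using int(2)[of t] st by simp
qed

theorem theorem3:
  fixes q c p\<^sub>0 :: real
  assumes "q > 1" and "c \<ge> 1"
    and "p\<^sub>0 > q" and "(p\<^sub>0 - q) / p\<^sub>0 * (p\<^sub>0 / (p\<^sub>0 - 1)) powr q * c = 1"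
  shows "(\<forall>p\<in>{q..<p\<^sub>0}. \<exists>c'>0. \<forall>g. admissible g \<and> reverse_Holder q c g \<longrightarrow> reverse_Holder p c' g)
    \<and> (\<forall>g. admissible g \<and> reverse_Holder q c g \<longrightarrow>
          (\<forall>p\<in>{q..<p\<^sub>0}. set_integrable lborel {0<..1} (\<lambda>x. g x powr p)))"
proof -
  define a where "a = (1 - 1 / p\<^sub>0) powr (q - 1)"
  \<comment> \<open>The constant is fixed before any \<open>g\<close> is chosen. It is positive
    because \<open>a < 1 \<le> c\<close> and \<open>p < p\<^sub>0\<close>.\<close>
  define c' where "c' p = (((c - a) / (1 - a)) powr (1 / q)) powr p / (1 - p / p\<^sub>0)" for p
  \<comment> \<open>Both sides of \<open>root\<close> become 1 when multiplied by
    \<open>(p\<^sub>0 / (p\<^sub>0 - 1)) powr q\<close>, so they are equal.\<close>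
  have "(1 - 1 / p\<^sub>0) * (p\<^sub>0 / (p\<^sub>0 - 1)) = 1"
    using assms(1,3) by (simp add: field_simps)
  then have "(1 - 1 / p\<^sub>0) powr q * (p\<^sub>0 / (p\<^sub>0 - 1)) powr q = 1"
    by (metis powr_mult powr_one_eq_one)
  moreover have "(c * (1 - q / p\<^sub>0)) * (p\<^sub>0 / (p\<^sub>0 - 1)) powr q = 1"
    using assms by (simp add: field_simps)
  ultimately have root: "(1 - 1 / p\<^sub>0) powr q = c * (1 - q / p\<^sub>0)"
    by (metis mult_cancel_right mult_zero_right zero_neq_one)
  have a: "a < 1"
    using assms(1,3) powr_less_mono2[of "q - 1" "1 - 1 / p\<^sub>0" 1] by (simp add: a_def)
  have "c' p > 0" if "p \<in> {q..<p\<^sub>0}" for p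
    using that a \<open>q > 1\<close> \<open>c \<ge> 1\<close> by (simp add: c'_def)
  moreover have rh: "reverse_Holder p (c' p) g"
    if "p \<in> {q..<p\<^sub>0}" "admissible g" "reverse_Holder q c g" for p g
    unfolding c'_def a_def using that assms(1-3) root
    by (intro reverse_Holder_self_improving) auto
  ultimately show ?thesis
    using reverse_Holder_imp_integrable by blast
qed

end
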